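(* Let $J$ be a free ideal on a set $S$ and let $k\ge 2$ be an integer. Let $\mathcal{A}\subseteq\langle J\rangle$ be a family of sets such that: 1. for each $X\in\mathcal{A}$ there is a $Y\in\mathcal{A}$ such that $X\subset Y$; 2. $(\mathcal{A},\subset)\not\rightarrow(\omega\text{-path})^{k}_{\omega/<\omega}$; 3. $\mathcal{A}$ has a coherent decomposition (with respect to $J$). Then player TWO has a winning $k$-tactic in the game $MG(\mathcal{A},J)$.
   Context: The symbol $\subset$ always means "is a proper subset of". A free ideal $J$ on $S$ is an ideal of subsets of $S$ with $\bigcup J=S$ (so it contains all finite subsets of $S$); $\langle J\rangle$ denotes the $\sigma$-completion of $J$, i.e. the collection of all unions of countably many members of $J$. Partition relation: for a partially ordered set $(P,<)$, a positive integer $n$ and an infinite cardinal $\lambda$, $(P,<)\rightarrow(\omega\text{-path})^{n}_{\lambda/<\omega}$ means that for every function $F:[P]^n\to\lambda$ there is an increasing sequence $p_1<p_2<\dots$ in $P$ such that $\{F(\{p_{j+1},\dots,p_{j+n}\}):j<\omega\}$ is finite; $\not\rightarrow$ denotes the negation. Coherent decomposition: $\mathcal{A}\subseteq\langle J\rangle$ has a coherent decomposition if there is for each $A\in\mathcal{A}$ a sequence $(A^n:n<\omega)$ of elements of $J$ with $A=\bigcup_{n<\omega}A^n$, $A^n\subseteq A^m$ whenever $n<m$, and such that for all $A\subset B$ in $\mathcal{A}$ there is an $m$ with $A^n\subseteq B^n$ for all $n\ge m$. Game $MG(\mathcal{A},J)$: in inning $n$ ($n=1,2,\dots$) ONE plays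 $O_n\in\mathcal{A}$ and TWO responds with $T_n\in J$; ONE must satisfy $O_n\subset O_{n+1}$ for all $n$. TWO wins if $\bigcup_n O_n\subseteq\bigcup_n T_n$. A $k$-tactic for TWO is a function $\Upsilon$ assigning an element of $J$ to each sequence $X_1\subset\dots\subset X_j$ ($1\le j\le k$) from $\mathcal{A}$; it is winning if TWO wins every play with $T_j=\Upsilon(O_1,\dots,O_j)$ for $j\le k$ and $T_{n+k}=\Upsilon(O_{n+1},\dots,O_{n+k})$ for all $n\geq 1$. *)

theory Defs
  imports "HOL-Library.FuncSet" "HOL-Library.Countable_Set" "HOL-Library.Ramsey"
begin

text \<open>Properness (\<open>S \<notin> J\<close>) is not required of an ideal.\<close>

definition set_ideal :: "'a set \<Rightarrow> 'a set set \<Rightarrow> bool" where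
  "set_ideal S J \<longleftrightarrow>
     J \<subseteq> Pow S \<and> {} \<in> J \<and>
     (\<forall>X\<in>J. \<forall>Y. Y \<subseteq> X \<longrightarrow> Y \<in> J) \<and>
     (\<forall>X\<in>J. \<forall>Y\<in>J. X \<union> Y \<in> J)"

definition free_ideal :: "'a set \<Rightarrow> 'a set set \<Rightarrow> bool" where
  "free_ideal S J \<longleftrightarrow> set_ideal S J \<and> \<Union> J = S"

definition sigma_completion :: "'a set set \<Rightarrow> 'a set set" where
  "sigma_completion J = {\<Union> C | C. C \<subseteq> J \<and> countable C}"

text \<open>
  The relation \<open>(P,<) \<rightarrow> (\<omega>-path)\<^sup>n\<close> with subscript \<open>\<lambda>/<\<omega>\<close>; the set \<open>C\<close> of colours stands
  for the cardinal \<open>\<lambda>\<close>. Sequences are indexed from 0, so \<open>p j\<close> is the \<open>(j+1)\<close>-st term and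
  \<open>p ` {j..<j + n}\<close> is the set of the \<open>n\<close> consecutive terms after the first \<open>j\<close>.
\<close>

definition omega_path_relation ::
    "'p set \<Rightarrow> ('p \<Rightarrow> 'p \<Rightarrow> bool) \<Rightarrow> nat \<Rightarrow> 'c set \<Rightarrow> bool" where
  "omega_path_relation P lt n C \<longleftrightarrow>
     (\<forall>F \<in> nsets P n \<rightarrow> C.
        \<exists>p :: nat \<Rightarrow> 'p.
          (\<forall>j. p j \<in> P) \<and> (\<forall>j. lt (p j) (p (Suc j))) \<and>
          finite {F (p ` {j..<j + n}) | j. True})"

definition has_coherent_decomposition :: "'a set set \<Rightarrow> 'a set set \<Rightarrow> bool" where
  "has_coherent_decomposition \<A> J \<longleftrightarrow>
     (\<exists>D :: 'a set \<Rightarrow> nat \<Rightarrow> 'a set.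
        (\<forall>A\<in>\<A>. (\<forall>n. D A n \<in> J) \<and> A = (\<Union>n. D A n) \<and>
                 (\<forall>n m. n < m \<longrightarrow> D A n \<subseteq> D A m)) \<and>
        (\<forall>A\<in>\<A>. \<forall>B\<in>\<A>. A \<subset> B \<longrightarrow> (\<exists>m. \<forall>n\<ge>m. D A n \<subseteq> D B n)))"

text \<open>
  The game \<open>MG(\<A>,J)\<close>. Innings are indexed from 0: \<open>X n\<close> and \<open>T n\<close> are the moves of ONE and
  TWO in the \<open>(n+1)\<close>-st inning.
\<close>

definition MG_play :: "'a set set \<Rightarrow> 'a set set \<Rightarrow> (nat \<Rightarrow> 'a set) \<Rightarrow> (nat \<Rightarrow> 'a set) \<Rightarrow> bool" where
  "MG_play \<A> J X T \<longleftrightarrow> (\<forall>n. X n \<in> \<A> \<and> X n \<subset> X (Suc n) \<and> T n \<in> J)"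

definition MG_TWO_wins :: "(nat \<Rightarrow> 'a set) \<Rightarrow> (nat \<Rightarrow> 'a set) \<Rightarrow> bool" where
  "MG_TWO_wins X T \<longleftrightarrow> (\<Union>n. X n) \<subseteq> (\<Union>n. T n)"

definition MG_tactic ::
    "nat \<Rightarrow> 'a set set \<Rightarrow> 'a set set \<Rightarrow> ('a set list \<Rightarrow> 'a set) \<Rightarrow> bool" where
  "MG_tactic k \<A> J \<Upsilon> \<longleftrightarrow>
     (\<forall>Xs. 1 \<le> length Xs \<and> length Xs \<le> k \<and> set Xs \<subseteq> \<A> \<and> sorted_wrt (\<subset>) Xs \<longrightarrow> \<Upsilon> Xs \<in> J)"

definition follows_tactic ::
    "nat \<Rightarrow> ('a set list \<Rightarrow> 'a set) \<Rightarrow> (nat \<Rightarrow> 'a set) \<Rightarrow> (nat \<Rightarrow> 'a set) \<Rightarrow> bool" where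
  "follows_tactic k \<Upsilon> X T \<longleftrightarrow>
     (\<forall>j<k. T j = \<Upsilon> (map X [0..<Suc j])) \<and>
     (\<forall>n. T (n + k) = \<Upsilon> (map X [Suc n..<Suc n + k]))"

definition MG_winning_tactic ::
    "nat \<Rightarrow> 'a set set \<Rightarrow> 'a set set \<Rightarrow> ('a set list \<Rightarrow> 'a set) \<Rightarrow> bool" where
  "MG_winning_tactic k \<A> J \<Upsilon> \<longleftrightarrow>
     MG_tactic k \<A> J \<Upsilon> \<and>
     (\<forall>X T. MG_play \<A> J X T \<and> follows_tactic k \<Upsilon> X T \<longrightarrow> MG_TWO_wins X T)"

end

theory Submission
  imports Defs
begin

text \<open>
  Let \<open>F\<close> witness the negative partition relation, and let \<open>m A B\<close> be a stage from which
  on the decomposition of \<open>A\<close> lies below that of \<open>B\<close>. Seeing \<open>X\<^sub>1 \<subset> \<dots> \<subset> X\<^sub>k\<close>, TWO plays the piece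
  of \<open>X\<^sub>k\<close> with index \<open>max (F {X\<^sub>1, \<dots>, X\<^sub>k}) (m X\<^sub>k\<^sub>-\<^sub>1 X\<^sub>k)\<close>. The choice of \<open>F\<close> makes these indices
  unbounded along every play. Whenever an index exceeds all earlier ones and is large enough for
  the first \<open>k\<close> moves, it dominates the values \<open>m\<close> between all consecutive moves of ONE so far, so
  coherence places the pieces of all earlier moves with this index inside TWO's answer.
\<close>

text \<open>The game is stripped away: \<open>g j\<close> is the threshold of coherence between
  \<open>X j\<close> and \<open>X (Suc j)\<close>, and \<open>M j\<close> is the index chosen on
  seeing the moves from \<open>j\<close> to \<open>Suc (j + q)\<close>.\<close>

lemma coherent_record_covers:
  fixes X :: "nat \<Rightarrow> 'a set" and M g :: "nat \<Rightarrow> nat"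
  assumes decomp: "\<And>j. X j = (\<Union>n. D (X j) n)"
    and mono: "\<And>j. mono (D (X j))"
    and coherent: "\<And>j n. g j \<le> n \<Longrightarrow> D (X j) n \<subseteq> D (X (Suc j)) n"
    and unbounded: "\<And>c. \<exists>j. c \<le> M j"
    and M_ge: "\<And>j. g (j + q) \<le> M j"
  shows "(\<Union>i. X i) \<subseteq> (\<Union>j. D (X (Suc (j + q))) (M j))"
proof
  fix x assume "x \<in> (\<Union>i. X i)"
  then obtain i r where x: "x \<in> D (X i) r"
    using decomp by blast
  \<comment> \<open>Exceeding \<open>r\<close> keeps \<open>x\<close> in the piece of
    \<open>X i\<close>, and exceeding \<open>M\<close> on \<open>{..i}\<close> puts the stage
    \<open>n\<close> below after \<open>i\<close>. The values of \<open>g\<close> on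
    \<open>{..q}\<close> are added since \<open>M_ge\<close> does not reach the thresholds before
    \<open>q\<close>.\<close>
  have "finite (insert r (M ` {..i} \<union> g ` {..q}))"
    by simp
  then obtain c where c: "\<And>v. v \<in> insert r (M ` {..i} \<union> g ` {..q}) \<Longrightarrow> v < c"
    unfolding finite_nat_set_iff_bounded by blast
  \<comment> \<open>As \<open>n\<close> is the first stage whose index reaches \<open>c\<close>,
    \<open>M n\<close> exceeds all earlier indices.\<close>
  define n where "n = (LEAST j. c \<le> M j)"
  have n: "c \<le> M n"
    unfolding n_def using unbounded by (rule LeastI_ex)
  have below: "M j < c" if "j < n" for j
    using not_less_Least[of j "\<lambda>j. c \<le> M j"] that by (simp add: n_def not_le)
  have "i < n"
    using c[of "M n"] n by (metis UnCI atMost_iff image_eqI insertCI leD not_le)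
  \<comment> \<open>A threshold beyond \<open>q\<close> is already bounded by
    \<open>M (j - q)\<close>, an index of stage \<open>n\<close> or earlier.\<close>
  have g_le: "g j \<le> M n" if "j \<le> n + q" for j
  proof (cases "j \<le> q")
    case True
    then show ?thesis
      using c[of "g j"] n by simp
  next
    case False
    then have "g j \<le> M (j - q)"
      using M_ge[of "j - q"] by simp
    also have "\<dots> \<le> M n"
    proof (cases "j = n + q")
      case False
      with that \<open>\<not> j \<le> q\<close> have "j - q < n"
        by linarith
      then show ?thesis
        using below n by (meson le_trans less_imp_le)
    qed simp
    finally show ?thesis .
  qed
  have "D (X i) (M n) \<subseteq> D (X l) (M n)" if "i \<le> l" "l \<le> Suc (n + q)" for l
    using that
  proof (induction l rule: dec_induct)
    case base
    then show ?case by simp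
  next
    case (step l)
    then show ?case
      using coherent[of l "M n"] g_le[of l] by auto
  qed
  then have "D (X i) (M n) \<subseteq> D (X (Suc (n + q))) (M n)"
    using \<open>i < n\<close> by simp
  moreover have "x \<in> D (X i) (M n)"
    using x monoD[OF mono, of r "M n" i] c[of r] n by auto
  ultimately show "x \<in> (\<Union>j. D (X (Suc (j + q))) (M j))"
    by blast
qed

text \<open>Colours are natural numbers, so a path with infinitely many colours has unbounded
  ones.\<close>

lemma not_omega_path_unbounded:
  assumes "\<not> omega_path_relation P lt n (UNIV :: nat set)"
  obtains F :: "'p set \<Rightarrow> nat" where
    "\<And>p c. (\<And>j. p j \<in> P) \<Longrightarrow> (\<And>j. lt (p j) (p (Suc j))) \<Longrightarrow> \<exists>j. c \<le> F (p ` {j..<j + n})"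
proof -
  from assms obtain F :: "'p set \<Rightarrow> nat" where
    F: "\<And>p. (\<And>j. p j \<in> P) \<Longrightarrow> (\<And>j. lt (p j) (p (Suc j))) \<Longrightarrow>
          infinite {F (p ` {j..<j + n}) | j. True}"
    unfolding omega_path_relation_def by blast
  show thesis
  proof (rule that)
    fix p :: "nat \<Rightarrow> 'p" and c
    assume "\<And>j. p j \<in> P" "\<And>j. lt (p j) (p (Suc j))"
    then have "infinite {F (p ` {j..<j + n}) | j. True}"
      by (rule F)
    then show "\<exists>j. c \<le> F (p ` {j..<j + n})"
      unfolding infinite_nat_iff_unbounded_le by blast
  qed
qed

theorem theorem17:
  fixes S :: "'a set" and J :: "'a set set" and \<A> :: "'a set set" and k :: nat
  assumes "free_ideal S J"
    and "k \<ge> 2"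
    and "\<A> \<subseteq> sigma_completion J"
    and "\<forall>X\<in>\<A>. \<exists>Y\<in>\<A>. X \<subset> Y"
    and "\<not> omega_path_relation \<A> (\<subset>) k (UNIV :: nat set)"
    and "has_coherent_decomposition \<A> J"
  shows "\<exists>\<Upsilon>. MG_winning_tactic k \<A> J \<Upsilon>"
proof -
  obtain q where k: "k = Suc (Suc q)"
    using \<open>k \<ge> 2\<close> by (metis add_2_eq_Suc le_iff_add)
  obtain F :: "'a set set \<Rightarrow> nat" where
    F: "\<And>X c. (\<And>j. X j \<in> \<A>) \<Longrightarrow> (\<And>j. X j \<subset> X (Suc j)) \<Longrightarrow> \<exists>j. c \<le> F (X ` {j..<j + k})"
    using not_omega_path_unbounded[OF assms(5)] by blast
  from assms(6) obtain D :: "'a set \<Rightarrow> nat \<Rightarrow> 'a set" where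
    decomp: "\<forall>A\<in>\<A>. (\<forall>n. D A n \<in> J) \<and> A = (\<Union>n. D A n) \<and>
      (\<forall>n m. n < m \<longrightarrow> D A n \<subseteq> D A m)"
    and coherent: "\<forall>A\<in>\<A>. \<forall>B\<in>\<A>. A \<subset> B \<longrightarrow> (\<exists>m. \<forall>n\<ge>m. D A n \<subseteq> D B n)"
    unfolding has_coherent_decomposition_def by (elim exE conjE) (rule that)
  have D: "D A n \<in> J" "A = (\<Union>n. D A n)" "n < l \<Longrightarrow> D A n \<subseteq> D A l" if "A \<in> \<A>" for A n l
    using bspec[OF decomp that] by iprover+
  from coherent obtain m where
    m: "\<And>A B n. A \<in> \<A> \<Longrightarrow> B \<in> \<A> \<Longrightarrow> A \<subset> B \<Longrightarrow> m A B \<le> n \<Longrightarrow> D A n \<subseteq> D B n"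
    by metis
  \<comment> \<open>Counting from 0, the last two of the \<open>k\<close> moves seen stand at
    \<open>q\<close> and \<open>Suc q\<close>. The default \<open>{}\<close> answers the innings
    before \<open>k\<close> moves are available.\<close>
  define \<Upsilon> where "\<Upsilon> Xs = (if length Xs = k
      then D (Xs ! Suc q) (max (F (set Xs)) (m (Xs ! q) (Xs ! Suc q))) else {})" for Xs
  have "{} \<in> J"
    using assms(1) by (simp add: free_ideal_def set_ideal_def)
  then have "MG_tactic k \<A> J \<Upsilon>"
    unfolding MG_tactic_def \<Upsilon>_def by (simp add: k D(1) subset_iff)
  moreover have "MG_TWO_wins X T" if play: "MG_play \<A> J X T" "follows_tactic k \<Upsilon> X T" for X T
  proof -
    have X: "X j \<in> \<A>" "X j \<subset> X (Suc j)" for j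
      using play(1) by (auto simp: MG_play_def)
    define M where
      "M j = max (F (X ` {j..<j + k})) (m (X (j + q)) (X (Suc (j + q))))" for j
    have T: "T (Suc (j + q)) = D (X (Suc (j + q))) (M j)" for j
    proof -
      \<comment> \<open>Inning \<open>Suc q\<close> is the first with \<open>k\<close> moves to see;
        it falls under the initial clause of \<open>follows_tactic\<close>, all later ones under the
        shifted clause.\<close>
      have "T (Suc (j + q)) = \<Upsilon> (map X [j..<j + k])"
      proof (cases j)
        case 0
        then show ?thesis
          using play(2) by (simp add: follows_tactic_def k del: upt_Suc)
      next
        case (Suc n)
        then have "Suc (j + q) = n + k" "[j..<j + k] = [Suc n..<Suc n + k]"
          by (simp_all add: k)
        then show ?thesis
          using play(2) unfolding follows_tactic_def by metis
      qed
      also have "\<dots> = D (X (Suc (j + q))) (M j)"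
        by (simp add: \<Upsilon>_def M_def k del: upt_Suc)
      finally show ?thesis .
    qed
    have "(\<Union>i. X i) \<subseteq> (\<Union>j. D (X (Suc (j + q))) (M j))"
    proof (rule coherent_record_covers)
      show "mono (D (X j))" for j
        using D(3)[OF X(1)] by (intro monoI) (metis le_less)
      show "D (X j) n \<subseteq> D (X (Suc j)) n" if "m (X j) (X (Suc j)) \<le> n" for j n
        using m[OF X(1) X(1) X(2) that] .
      show "\<exists>j. c \<le> M j" for c
        using F[of X c] X by (auto simp: M_def le_max_iff_disj)
      show "X j = (\<Union>n. D (X j) n)" for j
        using D(2)[OF X(1)] .
      show "m (X (j + q)) (X (Suc (j + q))) \<le> M j" for j
        by (simp add: M_def)
    qed
    \<comment> \<open>The answers from inning \<open>Suc q\<close> on suffice to cover all moves of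
      ONE.\<close>
    then show ?thesis
      unfolding MG_TWO_wins_def T[symmetric] by blast
  qed
  ultimately show ?thesis
    unfolding MG_winning_tactic_def by blast
qed

end
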